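(* The Ricci d-tensor of the Cartan canonical connection $C\Gamma_{[3]}$ of the rheonomic Chernov metric $$F_{[3]}(t,y)=\sqrt{h^{11}(t)}\cdot\sqrt[3]{y_1^1y_1^2y_1^3+y_1^1y_1^2y_1^4+y_1^1y_1^3y_1^4+y_1^2y_1^3y_1^4}$$ has the following effective local Ricci d-tensor components: $$R_{ij}:=R_{ijr}^r=\frac14\varkappa_{11}^1\varkappa_{11}^1\,\mathbb{S}_{(i)(j)}^{(1)(1)},\qquad P_{i(j)}^{\ (1)}=P_{(i)j}^{(1)}:=P_{ij(r)}^{r\ (1)}=\frac12\varkappa_{11}^1\,\mathbb{S}_{(i)(j)}^{(1)(1)},$$ $$\mathbb{S}_{(i)(j)}^{(1)(1)}=-9S_{[3]}^{pq1}S_{[3]}^{rm1}\left(S_{[3]ijp}S_{[3]qrm}-S_{[3]ipr}S_{[3]jqm}\right)+\frac1{12}\frac1{S_{[3]111}}S_{[3]ij1}-\frac1{18}\frac1{S_{[3]111}^2}S_{[3]i11}S_{[3]j11},$$ where $\mathbb{S}_{(i)(j)}^{(1)(1)}=S_{i(j)(r)}^{r(1)(1)}$ is the vertical Ricci d-tensor field.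
   Context: $M^4$ is a smooth $4$-dimensional manifold with local coordinates $(x^1,\dots,x^4)$; $J^1(\mathbb{R},M^4)$ has local coordinates $(t,x^1,\dots,x^4,y_1^1,\dots,y_1^4)$. $h_{11}(t)>0$ is a Riemannian metric on $\mathbb{R}$, $h^{11}=1/h_{11}$, and $\varkappa_{11}^1=\frac{h^{11}}{2}\frac{dh_{11}}{dt}$. Latin indices run from $1$ to $4$, repeated indices are summed; cube roots are real. Notation: $S_{[3]111}=y_1^1y_1^2y_1^3+y_1^1y_1^2y_1^4+y_1^1y_1^3y_1^4+y_1^2y_1^3y_1^4$; $S_{[3]i11}=\partial S_{[3]111}/\partial y_1^i$; $S_{[3]ij1}=\partial^2S_{[3]111}/\partial y_1^i\partial y_1^j$; $S_{[3]ijk}=\frac1{3!}$ if $i,j,k$ are distinct and $0$ otherwise. Everything is considered on the open set where $S_{[3]111}\ne0$ and $(S_{[3]ij1})$ is invertible; $(S_{[3]}^{jk1})$ is the inverse matrix. The fundamental metrical d-tensor is $g_{[3]ij}=\frac{h_{11}}{2}\frac{\partial^2F_{[3]}^2}{\partial y_1^i\partial y_1^j}$, with inverse $(g_{[3]}^{jk})$. The canonical nonlinear connection of $F_{[3]}$ is $M_{(1)1}^{(i)}=-\varkappa_{11}^1y_1^i$, $N_{(1)j}^{(i)}=-\frac{\varkappa_{11}^1}{2}\delta_j^i$, and $\frac{\delta}{\delta x^i}=\frac{\partial}{\partial x^i}+\frac{\varkappa_{11}^1}{2}\frac{\partial}{\partial y_1^i}$. The Cartan canonical connection has coefficients $$L_{jk}^i=\frac{g_{[3]}^{im}}{2}\left(\frac{\delta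 g_{[3]jm}}{\delta x^k}+\frac{\delta g_{[3]km}}{\delta x^j}-\frac{\delta g_{[3]jk}}{\delta x^m}\right),\qquad C_{j(k)}^{i(1)}=\frac{g_{[3]}^{im}}{2}\left(\frac{\partial g_{[3]jm}}{\partial y_1^k}+\frac{\partial g_{[3]km}}{\partial y_1^j}-\frac{\partial g_{[3]jk}}{\partial y_1^m}\right)$$ (the remaining ones being $\varkappa_{11}^1$ and $G_{j1}^k=0$). Its effective curvature d-tensors are $$R_{ijk}^l=\frac{\delta L_{ij}^l}{\delta x^k}-\frac{\delta L_{ik}^l}{\delta x^j}+L_{ij}^mL_{mk}^l-L_{ik}^mL_{mj}^l,\qquad P_{ij(k)}^{l\ (1)}=\frac{\partial L_{ij}^l}{\partial y_1^k}-C_{i(k)|j}^{l(1)}+C_{i(m)}^{l(1)}P_{(1)j(k)}^{(m)\ (1)},$$ $$S_{i(j)(k)}^{l(1)(1)}=\frac{\partial C_{i(j)}^{l(1)}}{\partial y_1^k}-\frac{\partial C_{i(k)}^{l(1)}}{\partial y_1^j}+C_{i(j)}^{m(1)}C_{m(k)}^{l(1)}-C_{i(k)}^{m(1)}C_{m(j)}^{l(1)},$$ where $P_{(1)j(k)}^{(m)\ (1)}=\frac{\partial N_{(1)j}^{(m)}}{\partial y_1^k}-L_{kj}^m$ and $C_{i(k)|j}^{l(1)}=\frac{\delta C_{i(k)}^{l(1)}}{\delta x^j}+C_{i(k)}^{m(1)}L_{mj}^l-C_{m(k)}^{l(1)}L_{ij}^m-C_{i(m)}^{l(1)}L_{kj}^m$.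 The Ricci d-tensor components are the contractions of these indicated in the claim. *)

theory Defs
  imports "HOL-Analysis.Analysis"
begin

text \<open>
  Everything is written in the local coordinates \<open>(t, x, y)\<close> of \<open>J\<^sup>1(\<real>, M\<^sup>4)\<close>. The components of a
  d-tensor or of a connection are functions of \<open>t\<close>, \<open>x\<close> and \<open>y\<close>, preceded by their indices.
  The index type is \<^typ>\<open>4\<close>, whose elements are \<open>1, 2, 3\<close> and \<open>4\<close> (with \<open>4 = 0\<close>).
  Upper indices come before lower ones, and otherwise the order is that of the usual notation:
  \<open>R_curv h l i j k\<close> is \<open>R\<^sup>l\<^bsub>ijk\<^esub>\<close>, \<open>C_conn h i j k\<close> is \<open>C\<^sup>i\<^bsub>j(k)\<^esub>\<close>, and so on.
  The parameter \<open>h\<close> is the metric \<open>h\<^bsub>11\<^esub>\<close> on \<open>\<real>\<close>.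
\<close>

type_synonym jet_fun = "real \<Rightarrow> real^4 \<Rightarrow> real^4 \<Rightarrow> real"

definition pd :: "4 \<Rightarrow> (real^4 \<Rightarrow> real) \<Rightarrow> real^4 \<Rightarrow> real" where
  "pd i f v = deriv (\<lambda>s. f (v + s *\<^sub>R axis i 1)) 0"

definition dx :: "4 \<Rightarrow> jet_fun \<Rightarrow> jet_fun" where
  "dx i f t x y = pd i (\<lambda>x'. f t x' y) x"

definition dy :: "4 \<Rightarrow> jet_fun \<Rightarrow> jet_fun" where
  "dy i f t x y = pd i (\<lambda>y'. f t x y') y"

definition smooth_fun :: "(real \<Rightarrow> real) \<Rightarrow> bool" where
  "smooth_fun h \<longleftrightarrow> (\<forall>n. (deriv ^^ n) h differentiable_on UNIV)"

definition riemannian_metric_R :: "(real \<Rightarrow> real) \<Rightarrow> bool" where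
  "riemannian_metric_R h \<longleftrightarrow> smooth_fun h \<and> (\<forall>t. h t > 0)"

definition h_up :: "(real \<Rightarrow> real) \<Rightarrow> real \<Rightarrow> real" where
  "h_up h t = 1 / h t"

definition kappa :: "(real \<Rightarrow> real) \<Rightarrow> real \<Rightarrow> real" where
  "kappa h t = h_up h t / 2 * deriv h t"

definition S111 :: "real^4 \<Rightarrow> real" where
  "S111 y = y$1 * y$2 * y$3 + y$1 * y$2 * y$4 + y$1 * y$3 * y$4 + y$2 * y$3 * y$4"

definition Si11 :: "4 \<Rightarrow> real^4 \<Rightarrow> real" where
  "Si11 i = pd i S111"

definition Sij1 :: "4 \<Rightarrow> 4 \<Rightarrow> real^4 \<Rightarrow> real" where
  "Sij1 i j = pd i (pd j S111)"

text \<open>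
  \<open>Sijk\<close> consists of the coefficients of the symmetric trilinear form whose cubic form is \<^const>\<open>S111\<close>.
  It is one sixth of the third derivative of \<^const>\<open>S111\<close>, whereas \<^const>\<open>Si11\<close> and \<^const>\<open>Sij1\<close> are
  derivatives without such a factor.
\<close>

definition Sijk :: "4 \<Rightarrow> 4 \<Rightarrow> 4 \<Rightarrow> real" where
  "Sijk i j k = (if i \<noteq> j \<and> j \<noteq> k \<and> i \<noteq> k then 1 / fact 3 else 0)"

definition Sij1_matrix :: "real^4 \<Rightarrow> real^4^4" where
  "Sij1_matrix y = (\<chi> i j. Sij1 i j y)"

definition Sjk1_up :: "4 \<Rightarrow> 4 \<Rightarrow> real^4 \<Rightarrow> real" where
  "Sjk1_up j k y = matrix_inv (Sij1_matrix y) $ j $ k"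

definition F_chernov :: "(real \<Rightarrow> real) \<Rightarrow> jet_fun" where
  "F_chernov h t x y = sqrt (h_up h t) * root 3 (S111 y)"

definition g_fund :: "(real \<Rightarrow> real) \<Rightarrow> 4 \<Rightarrow> 4 \<Rightarrow> jet_fun" where
  "g_fund h i j t x y = h t / 2 * dy i (dy j (\<lambda>t x y. (F_chernov h t x y)\<^sup>2)) t x y"

definition g_up :: "(real \<Rightarrow> real) \<Rightarrow> 4 \<Rightarrow> 4 \<Rightarrow> jet_fun" where
  "g_up h j k t x y = matrix_inv (\<chi> a b. g_fund h a b t x y) $ j $ k"

definition N_conn :: "(real \<Rightarrow> real) \<Rightarrow> 4 \<Rightarrow> 4 \<Rightarrow> jet_fun" where
  "N_conn h i j t x y = - (kappa h t / 2) * (if i = j then 1 else 0)"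

text \<open>
  The adapted derivative \<open>\<delta>/\<delta>x\<^sup>i = \<partial>/\<partial>x\<^sup>i - N\<^sup>m\<^sub>i \<partial>/\<partial>y\<^sup>m\<close>, with the values of \<^const>\<open>N_conn\<close> inserted.
\<close>

definition delta_x :: "(real \<Rightarrow> real) \<Rightarrow> 4 \<Rightarrow> jet_fun \<Rightarrow> jet_fun" where
  "delta_x h i f t x y = dx i f t x y + kappa h t / 2 * dy i f t x y"

definition L_conn :: "(real \<Rightarrow> real) \<Rightarrow> 4 \<Rightarrow> 4 \<Rightarrow> 4 \<Rightarrow> jet_fun" where
  "L_conn h i j k t x y =
    (\<Sum>m\<in>UNIV. g_up h i m t x y / 2 *
      (delta_x h k (g_fund h j m) t x y + delta_x h j (g_fund h k m) t x y
        - delta_x h m (g_fund h j k) t x y))"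

definition C_conn :: "(real \<Rightarrow> real) \<Rightarrow> 4 \<Rightarrow> 4 \<Rightarrow> 4 \<Rightarrow> jet_fun" where
  "C_conn h i j k t x y =
    (\<Sum>m\<in>UNIV. g_up h i m t x y / 2 *
      (dy k (g_fund h j m) t x y + dy j (g_fund h k m) t x y - dy m (g_fund h j k) t x y))"

definition R_curv :: "(real \<Rightarrow> real) \<Rightarrow> 4 \<Rightarrow> 4 \<Rightarrow> 4 \<Rightarrow> 4 \<Rightarrow> jet_fun" where
  "R_curv h l i j k t x y =
    delta_x h k (L_conn h l i j) t x y - delta_x h j (L_conn h l i k) t x y
    + (\<Sum>m\<in>UNIV. L_conn h m i j t x y * L_conn h l m k t x y)
    - (\<Sum>m\<in>UNIV. L_conn h m i k t x y * L_conn h l m j t x y)"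

text \<open>The torsion d-tensor \<open>P\<^sup>(\<^sup>m\<^sup>)\<^bsub>(1)j(k)\<^esub>\<close>.\<close>

definition P_tors :: "(real \<Rightarrow> real) \<Rightarrow> 4 \<Rightarrow> 4 \<Rightarrow> 4 \<Rightarrow> jet_fun" where
  "P_tors h m j k t x y = dy k (N_conn h m j) t x y - L_conn h m k j t x y"

text \<open>\<open>C_cov h l i k j\<close> is the horizontal covariant derivative \<open>C\<^sup>l\<^bsub>i(k)|j\<^esub>\<close>.\<close>

definition C_cov :: "(real \<Rightarrow> real) \<Rightarrow> 4 \<Rightarrow> 4 \<Rightarrow> 4 \<Rightarrow> 4 \<Rightarrow> jet_fun" where
  "C_cov h l i k j t x y =
    delta_x h j (C_conn h l i k) t x y
    + (\<Sum>m\<in>UNIV. C_conn h m i k t x y * L_conn h l m j t x y)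
    - (\<Sum>m\<in>UNIV. C_conn h l m k t x y * L_conn h m i j t x y)
    - (\<Sum>m\<in>UNIV. C_conn h l i m t x y * L_conn h m k j t x y)"

definition P_curv :: "(real \<Rightarrow> real) \<Rightarrow> 4 \<Rightarrow> 4 \<Rightarrow> 4 \<Rightarrow> 4 \<Rightarrow> jet_fun" where
  "P_curv h l i j k t x y =
    dy k (L_conn h l i j) t x y - C_cov h l i k j t x y
    + (\<Sum>m\<in>UNIV. C_conn h l i m t x y * P_tors h m j k t x y)"

definition S_curv :: "(real \<Rightarrow> real) \<Rightarrow> 4 \<Rightarrow> 4 \<Rightarrow> 4 \<Rightarrow> 4 \<Rightarrow> jet_fun" where
  "S_curv h l i j k t x y =
    dy k (C_conn h l i j) t x y - dy j (C_conn h l i k) t x y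
    + (\<Sum>m\<in>UNIV. C_conn h m i j t x y * C_conn h l m k t x y)
    - (\<Sum>m\<in>UNIV. C_conn h m i k t x y * C_conn h l m j t x y)"

definition Ricci_R :: "(real \<Rightarrow> real) \<Rightarrow> 4 \<Rightarrow> 4 \<Rightarrow> jet_fun" where
  "Ricci_R h i j t x y = (\<Sum>r\<in>UNIV. R_curv h r i j r t x y)"

text \<open>
  The two mixed components \<open>P\<^bsub>i(j)\<^esub>\<close> and \<open>P\<^bsub>(i)j\<^esub>\<close> of the Ricci d-tensor are both given by the
  contraction \<open>P\<^sup>r\<^bsub>ij(r)\<^esub>\<close>.
\<close>

definition Ricci_P_hv :: "(real \<Rightarrow> real) \<Rightarrow> 4 \<Rightarrow> 4 \<Rightarrow> jet_fun" where
  "Ricci_P_hv h i j t x y = (\<Sum>r\<in>UNIV. P_curv h r i j r t x y)"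

definition Ricci_P_vh :: "(real \<Rightarrow> real) \<Rightarrow> 4 \<Rightarrow> 4 \<Rightarrow> jet_fun" where
  "Ricci_P_vh h i j t x y = (\<Sum>r\<in>UNIV. P_curv h r i j r t x y)"

definition Ricci_S :: "(real \<Rightarrow> real) \<Rightarrow> 4 \<Rightarrow> 4 \<Rightarrow> jet_fun" where
  "Ricci_S h i j t x y = (\<Sum>r\<in>UNIV. S_curv h r i j r t x y)"

end

theory Submission
  imports Defs
begin

text \<open>
  Write \<open>S\<close>, \<open>s\<^sub>i\<close>, \<open>A\<^sub>i\<^sub>j\<close>, \<open>T\<^sub>i\<^sub>j\<^sub>k\<close> for the cubic form and its derivatives and \<open>B = A\<^sup>-\<^sup>1\<close>. The metric
  \<open>g = D\<^sup>2(S\<^sup>2\<^sup>/\<^sup>3)/2\<close> is a Hessian that depends on neither \<open>t\<close> nor \<open>x\<close>, so \<open>\<delta>/\<delta>x\<close> acts as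
  \<open>\<kappa>/2 \<cdot> \<partial>/\<partial>y\<close>, hence \<open>L = \<kappa>/2 \<cdot> C\<close>, and the curvatures \<open>R\<close> and \<open>P\<close> are \<open>\<kappa>\<^sup>2/4\<close> and \<open>\<kappa>/2\<close> times the
  vertical curvature. As the fourth derivatives of \<open>S\<^sup>2\<^sup>/\<^sup>3\<close> are symmetric and
  \<open>\<partial>\<^sub>kg\<^sup>-\<^sup>1 = - g\<^sup>-\<^sup>1 (\<partial>\<^sub>kg) g\<^sup>-\<^sup>1\<close>, the vertical curvature is the commutator \<open>C\<^sub>j C\<^sub>k - C\<^sub>k C\<^sub>j\<close> of the matrices
  \<open>(C\<^sub>k)\<^sup>l\<^sub>m = C\<^sup>l\<^bsub>m(k)\<^esub>\<close>. Euler's relations \<open>Ty = A\<close>, \<open>Ay = 2s\<close>, \<open>s \<cdot> y = 3S\<close>, \<open>Bs = y/2\<close>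
  invert \<open>g\<close> by a rank-one correction of \<open>B\<close>, give \<open>C\<close> in closed form, and make \<open>C\<close> vanish on contraction
  with \<open>s\<close> above or with \<open>y\<close> below. This removes most terms from the two contractions left to compute.
\<close>

section \<open>The derivative of the inverse of a matrix\<close>

lemma matrix_inv_inverse:
  fixes A :: "'a::semiring_1^'n^'m"
  assumes "invertible A"
  shows "A ** matrix_inv A = mat 1" "matrix_inv A ** A = mat 1"
  using someI_ex[OF assms[unfolded invertible_def]] by (auto simp: matrix_inv_def)

lemma matrix_inv_unique:
  fixes A :: "'a::semiring_1^'n^'m"
  assumes "A ** B = mat 1" "B ** A = mat 1"
  shows "matrix_inv A = B"
proof -
  have "invertible A"
    using assms by (auto simp: invertible_def)
  then have "matrix_inv A = matrix_inv A ** (A ** B)"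
    by (simp add: assms)
  also have "\<dots> = B"
    using \<open>invertible A\<close> by (simp add: matrix_mul_assoc matrix_inv_inverse)
  finally show ?thesis .
qed

lemma field_differentiable_det:
  fixes M :: "'b::real_normed_field \<Rightarrow> 'b^'n^'n"
  assumes "\<And>a b. (\<lambda>s. M s $ a $ b) field_differentiable at t"
  shows "(\<lambda>s. det (M s)) field_differentiable at t"
proof -
  have "(\<lambda>s. \<Prod>i\<in>I. M s $ i $ p i) field_differentiable at t" for I p
    by (induction I rule: infinite_finite_induct) (auto intro!: derivative_intros assms)
  then show ?thesis
    unfolding det_def by (intro derivative_intros) auto
qed

text \<open>Column \<open>b\<close> of the inverse solves the linear system with right-hand side
  \<open>axis b 1\<close>. Entries of the inverse become quotients of determinants, which are easy
  to differentiate.\<close>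

lemma matrix_inv_entry_cramer:
  fixes A :: "'a::field^'n^'n"
  assumes "det A \<noteq> 0"
  shows "matrix_inv A $ a $ b = det (\<chi> i j. if j = a then axis b 1 $ i else A $ i $ j) / det A"
proof -
  have "A *v (matrix_inv A *v axis b 1) = axis b 1"
    using assms by (simp add: matrix_vector_mul_assoc matrix_inv_inverse invertible_det_nz)
  then have "matrix_inv A *v axis b 1 =
      (\<chi> k. det (\<chi> i j. if j = k then axis b 1 $ i else A $ i $ j) / det A)"
    using cramer[OF assms] by blast
  moreover have "(matrix_inv A *v axis b 1) $ a = matrix_inv A $ a $ b"
    by (simp add: matrix_vector_mult_def axis_def if_distrib cong: if_cong)
  ultimately show ?thesis
    by simp
qed

text \<open>Cramer's rule yields differentiability; the value then follows by differentiating
  \<open>M s ** matrix_inv (M s)\<close>, which is constant near \<open>t\<close>.\<close>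

lemma matrix_inv_entry_has_field_derivative:
  fixes M :: "'b::real_normed_field \<Rightarrow> 'b^'n^'n"
  assumes M: "\<And>a b. ((\<lambda>s. M s $ a $ b) has_field_derivative M' $ a $ b) (at t)"
    and inv: "invertible (M t)"
  shows "((\<lambda>s. matrix_inv (M s) $ a $ b) has_field_derivative
    - (matrix_inv (M t) ** M' ** matrix_inv (M t)) $ a $ b) (at t)"
proof -
  let ?B = "\<lambda>s. matrix_inv (M s)"
  have diff: "(\<lambda>s. M s $ a $ b) field_differentiable at t" for a b
    using M field_differentiable_def by blast
  have det: "(\<lambda>s. det (M s)) field_differentiable at t"
    by (intro field_differentiable_det diff)
  have "det (M t) \<noteq> 0"
    using inv by (simp add: invertible_det_nz)
  moreover have "isCont (\<lambda>s. det (M s)) t"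
    using det by (rule field_differentiable_imp_continuous_at)
  then have "((\<lambda>s. det (M s)) \<longlongrightarrow> det (M t)) (nhds t)"
    using tendsto_at_iff_tendsto_nhds[of "\<lambda>s. det (M s)" t] by (simp add: isCont_def)
  \<comment> \<open>Invertibility spreads from \<open>t\<close> to nearby points, where Cramer's
    rule and the inverse identity are applied.\<close>
  ultimately have ev: "\<forall>\<^sub>F s in nhds t. det (M s) \<noteq> 0"
    by (intro tendsto_imp_eventually_ne)
  have "(\<lambda>s. ?B s $ a $ b) field_differentiable at t" for a b
  proof -
    let ?N = "\<lambda>s. \<chi> i j. if j = a then axis b 1 $ i else M s $ i $ j"
    have "(\<lambda>s. ?N s $ i $ j) field_differentiable at t" for i j
      using diff by (cases "j = a") auto
    then have "(\<lambda>s. det (?N s)) field_differentiable at t"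
      by (rule field_differentiable_det)
    then have "(\<lambda>s. det (?N s) / det (M s)) field_differentiable at t"
      using det \<open>det (M t) \<noteq> 0\<close> by (rule field_differentiable_divide)
    moreover have ev': "\<forall>\<^sub>F s in nhds t. ?B s $ a $ b = det (?N s) / det (M s)"
      using ev by eventually_elim (rule matrix_inv_entry_cramer)
    ultimately show ?thesis
      unfolding field_differentiable_def DERIV_cong_ev[OF refl ev' refl] by simp
  qed
  then have B: "((\<lambda>s. ?B s $ a $ b) has_field_derivative deriv (\<lambda>s. ?B s $ a $ b) t) (at t)" for a b
    by (simp add: field_differentiable_derivI)
  define D where "D = (\<chi> a b. deriv (\<lambda>s. ?B s $ a $ b) t)"
  have "M' ** ?B t + M t ** D = 0"
  proof -
    have "(M' ** ?B t + M t ** D) $ a $ b = 0" for a b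
    proof -
      have "((\<lambda>s. \<Sum>c\<in>UNIV. M s $ a $ c * ?B s $ c $ b) has_field_derivative
          (\<Sum>c\<in>UNIV. M' $ a $ c * ?B t $ c $ b + D $ c $ b * M t $ a $ c)) (at t)"
        unfolding D_def using B by (intro DERIV_sum DERIV_mult M) simp
      then have "((\<lambda>s. (M s ** ?B s) $ a $ b) has_field_derivative (M' ** ?B t + M t ** D) $ a $ b) (at t)"
        by (simp add: matrix_matrix_mult_def sum.distrib mult.commute)
      moreover have "((\<lambda>s. (M s ** ?B s) $ a $ b) has_field_derivative 0) (at t)"
      proof -
        have "\<forall>\<^sub>F s in nhds t. (M s ** ?B s) $ a $ b = mat 1 $ a $ b"
          using ev by eventually_elim (simp add: matrix_inv_inverse invertible_det_nz)
        then show ?thesis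
          by (subst DERIV_cong_ev[OF refl _ refl]) auto
      qed
      ultimately show ?thesis
        by (rule DERIV_unique)
    qed
    then show ?thesis
      by (simp add: vec_eq_iff)
  qed
  then have "M t ** D = - (M' ** ?B t)"
    by (rule add.inverse_unique[symmetric])
  then have "?B t ** M t ** D = ?B t ** - (M' ** ?B t)"
    by (simp flip: matrix_mul_assoc)
  also have "\<dots> = - (?B t ** M' ** ?B t)"
    unfolding matrix_mul_assoc[symmetric]
    by (simp add: vec_eq_iff matrix_matrix_mult_def[of "?B t"] sum_negf)
  finally have "D = - (?B t ** M' ** ?B t)"
    by (simp add: matrix_inv_inverse[OF inv])
  then show ?thesis
    using B[of a b] by (simp add: D_def vec_eq_iff del: vector_uminus_component) (simp add: D_def)
qed

section \<open>Derivatives of the cubic form and of the metric\<close>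

text \<open>Asserts existence along with the value, whereas \<open>pd\<close> returns a number even
  where no derivative exists.\<close>

abbreviation has_pd :: "4 \<Rightarrow> (real^4 \<Rightarrow> real) \<Rightarrow> real \<Rightarrow> real^4 \<Rightarrow> bool" where
  "has_pd k f D y \<equiv> ((\<lambda>s. f (y + s *\<^sub>R axis k 1)) has_real_derivative D) (at 0)"

lemma pd_eqI: "has_pd k f D y \<Longrightarrow> pd k f y = D"
  unfolding pd_def by (rule DERIV_imp_deriv)

lemma eventually_along_axis:
  fixes y :: "real^'n"
  assumes "\<forall>\<^sub>F v in nhds y. P v"
  shows "\<forall>\<^sub>F s in nhds 0. P (y + s *\<^sub>R axis k 1)"
proof -
  have "((\<lambda>s. y + s *\<^sub>R axis k 1) \<longlongrightarrow> y + 0 *\<^sub>R axis k 1) (nhds 0)"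
    by (intro tendsto_intros filterlim_ident)
  then show ?thesis
    using assms by (simp add: filterlim_iff)
qed

text \<open>Closed forms of the metric and the connection are available only where
  \<open>S111\<close> is nonzero, hence near the point.\<close>

lemma has_pd_cong:
  assumes "\<forall>\<^sub>F v in nhds y. f v = g v" "has_pd k g D y"
  shows "has_pd k f D y"
  using DERIV_cong_ev[OF refl eventually_along_axis[OF assms(1)] refl] assms(2) by simp

lemma has_pd_component: "has_pd k (\<lambda>v. v $ r) (if r = k then 1 else 0) y"
  by (auto intro!: derivative_eq_intros simp: axis_def)

lemma Sijk_sym: "Sijk i j k = Sijk j i k" "Sijk i j k = Sijk i k j"
  by (auto simp: Sijk_def)

lemma sum_delta_add:
  fixes f g :: "'a::finite \<Rightarrow> 'b::comm_semiring_1"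
  shows "(\<Sum>i\<in>UNIV. f i * (if i = k then 1 else 0) + g i) = f k + (\<Sum>i\<in>UNIV. g i)"
  by (subst sum.distrib) (simp add: if_distrib cong: if_cong)

text \<open>
  Euler's relations serve as definitions here, so that they need no separate proof.
\<close>

definition Sij1_form :: "4 \<Rightarrow> 4 \<Rightarrow> real^4 \<Rightarrow> real" where
  "Sij1_form i j y = (\<Sum>r\<in>UNIV. 6 * Sijk i j r * y $ r)"

definition Si11_form :: "4 \<Rightarrow> real^4 \<Rightarrow> real" where
  "Si11_form i y = (\<Sum>j\<in>UNIV. Sij1_form i j y * y $ j) / 2"

lemma Sij1_form_sym: "Sij1_form i j y = Sij1_form j i y"
  unfolding Sij1_form_def by (simp only: Sijk_sym(1))

lemma S111_Si11_form: "S111 y = (\<Sum>i\<in>UNIV. Si11_form i y * y $ i) / 3"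
  unfolding Si11_form_def Sij1_form_def sum_4 Sijk_def S111_def
  by (simp add: fact_numeral field_simps)

lemma has_pd_Sij1_form: "has_pd k (Sij1_form i j) (6 * Sijk i j k) y"
  unfolding Sij1_form_def
  by (rule derivative_eq_intros has_pd_component refl)+
    (simp add: if_distrib if_distribR cong: if_cong)

text \<open>The product rule yields the same entry twice, once from \<open>y $ j\<close> and once
  from the coefficients; this cancels the division by 2.\<close>

lemma has_pd_Si11_form: "has_pd k (Si11_form i) (Sij1_form k i y) y"
proof -
  have "has_pd k (Si11_form i)
      ((\<Sum>j\<in>UNIV. Sij1_form i j y * (if j = k then 1 else 0) + 6 * Sijk i j k * y $ j) / 2) y"
    unfolding Si11_form_def
    by (rule DERIV_cdivide derivative_eq_intros has_pd_component has_pd_Sij1_form refl)+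
      (simp add: add.commute mult.commute)
  moreover have "(\<Sum>j\<in>UNIV. 6 * Sijk i j k * y $ j) = Sij1_form i k y"
    unfolding Sij1_form_def by (simp only: Sijk_sym(2)[of i k])
  ultimately show ?thesis
    by (simp only: sum_delta_add Sij1_form_sym[of k i]) simp
qed

lemma has_pd_S111_form: "has_pd k S111 (Si11_form k y) y"
proof -
  have "has_pd k S111
      ((\<Sum>i\<in>UNIV. Si11_form i y * (if i = k then 1 else 0) + Sij1_form k i y * y $ i) / 3) y"
    unfolding S111_Si11_form
    by (rule DERIV_cdivide derivative_eq_intros has_pd_component has_pd_Si11_form refl)+
      (simp add: add.commute mult.commute)
  moreover have "(\<Sum>i\<in>UNIV. Sij1_form k i y * y $ i) = 2 * Si11_form k y"
    by (simp add: Si11_form_def)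
  ultimately show ?thesis
    by (simp only: sum_delta_add) simp
qed

lemma Si11_eq_form: "Si11 = Si11_form"
  unfolding Si11_def using pd_eqI[OF has_pd_S111_form] by blast

lemma Sij1_eq_form: "Sij1 = Sij1_form"
proof (intro ext)
  fix i j y
  have "Sij1 i j y = pd i (Si11 j) y"
    by (simp add: Sij1_def Si11_def)
  then show "Sij1 i j y = Sij1_form i j y"
    using pd_eqI[OF has_pd_Si11_form] by (simp add: Si11_eq_form)
qed

lemmas has_pd_S111 = has_pd_S111_form[folded Si11_eq_form]
  and has_pd_Si11 = has_pd_Si11_form[folded Si11_eq_form Sij1_eq_form]
  and has_pd_Sij1 = has_pd_Sij1_form[folded Sij1_eq_form]
  and Sij1_sym = Sij1_form_sym[folded Sij1_eq_form]

lemma Sijk_contract: "(\<Sum>r\<in>UNIV. Sijk i j r * y $ r) = Sij1 i j y / 6"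
  by (simp add: Sij1_eq_form Sij1_form_def mult.assoc flip: sum_distrib_left)

lemma Sij1_contract: "(\<Sum>j\<in>UNIV. Sij1 i j y * y $ j) = 2 * Si11 i y"
  by (simp add: Sij1_eq_form Si11_eq_form Si11_form_def)

lemma Si11_contract: "(\<Sum>i\<in>UNIV. Si11 i y * y $ i) = 3 * S111 y"
  by (simp add: Si11_eq_form S111_Si11_form)

lemma eventually_S111_nonzero:
  assumes "S111 y \<noteq> 0"
  shows "\<forall>\<^sub>F v in nhds y. S111 v \<noteq> 0"
proof -
  have "isCont S111 y"
    unfolding S111_def by (intro continuous_intros)
  then have "(S111 \<longlongrightarrow> S111 y) (nhds y)"
    using tendsto_at_iff_tendsto_nhds[of S111 y] by (simp add: isCont_def)
  then show ?thesis
    using assms by (rule tendsto_imp_eventually_ne)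
qed

text \<open>
  The derivatives of \<open>u = S\<^sup>-\<^sup>1\<^sup>/\<^sup>3/3\<close> and \<open>w = S\<^sup>-\<^sup>1\<close> are polynomials in \<open>u\<close>, \<open>w\<close> and \<open>s\<close>, which keeps all
  derivatives of the metric polynomial.
\<close>

definition u_fac :: "real^4 \<Rightarrow> real" where
  "u_fac y = 1 / (3 * root 3 (S111 y))"

definition w_fac :: "real^4 \<Rightarrow> real" where
  "w_fac y = 1 / S111 y"

text \<open>The real root of odd order is differentiable at negative arguments too.\<close>

lemma has_pd_root_S111:
  assumes "S111 y \<noteq> 0"
  shows "has_pd k (\<lambda>v. root 3 (S111 v)) (Si11 k y / (3 * (root 3 (S111 y))\<^sup>2)) y"
proof -
  have "has_pd k (\<lambda>v. root 3 (S111 v)) (inverse (3 * (root 3 (S111 (y + 0 *\<^sub>R axis k 1)))\<^sup>2) * Si11 k y) y"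
    using DERIV_chain2[OF DERIV_odd_real_root[of 3] has_pd_S111[where k = k and y = y]] assms by simp
  then show ?thesis
    by (simp add: field_simps)
qed

lemma has_pd_u_fac:
  assumes "S111 y \<noteq> 0"
  shows "has_pd k u_fac (- u_fac y * w_fac y * Si11 k y / 3) y"
proof -
  \<comment> \<open>Writing \<open>S111 y\<close> as \<open>\<rho> ^ 3\<close> makes every term
    rational in \<open>\<rho>\<close>.\<close>
  define \<rho> where "\<rho> = root 3 (S111 y)"
  have \<rho>: "S111 y = \<rho> ^ 3" "\<rho> \<noteq> 0"
    using assms by (simp_all add: \<rho>_def odd_real_root_pow)
  have "has_pd k u_fac (- (3 * (Si11 k y / (3 * \<rho>\<^sup>2))) / (3 * \<rho>)\<^sup>2) y"
    using DERIV_inverse_fun[OF DERIV_cmult[OF has_pd_root_S111[OF assms, of k], where c = 3]] \<rho>(2)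
    by (simp add: u_fac_def inverse_eq_divide power2_eq_square flip: \<rho>_def)
  moreover have "- (3 * (Si11 k y / (3 * \<rho>\<^sup>2))) / (3 * \<rho>)\<^sup>2 = - u_fac y * w_fac y * Si11 k y / 3"
    unfolding u_fac_def w_fac_def \<rho>_def[symmetric] unfolding \<rho>(1)
    using \<rho>(2) by (simp add: field_simps power2_eq_square power3_eq_cube)
  ultimately show ?thesis
    by (simp only:)
qed

lemma has_pd_w_fac:
  assumes "S111 y \<noteq> 0"
  shows "has_pd k w_fac (- (w_fac y)\<^sup>2 * Si11 k y) y"
  unfolding w_fac_def
  by (rule derivative_eq_intros has_pd_S111 refl)+
    (use assms in \<open>simp_all add: power2_eq_square\<close>)

text \<open>
  \<open>g3\<close> and \<open>g4\<close> are the first and second derivatives of the metric \<open>g2\<close>, i.e. the third and fourth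
  derivatives of \<open>S\<^sup>2\<^sup>/\<^sup>3/2\<close>.
\<close>

definition g2 :: "4 \<Rightarrow> 4 \<Rightarrow> real^4 \<Rightarrow> real" where
  "g2 i j y = u_fac y * (Sij1 i j y - w_fac y / 3 * Si11 i y * Si11 j y)"

definition g3 :: "4 \<Rightarrow> 4 \<Rightarrow> 4 \<Rightarrow> real^4 \<Rightarrow> real" where
  "g3 i j k y = u_fac y * (6 * Sijk i j k
     - w_fac y / 3 * (Sij1 i j y * Si11 k y + Sij1 i k y * Si11 j y + Sij1 j k y * Si11 i y)
     + 4/9 * (w_fac y)\<^sup>2 * Si11 i y * Si11 j y * Si11 k y)"

definition g4 :: "4 \<Rightarrow> 4 \<Rightarrow> 4 \<Rightarrow> 4 \<Rightarrow> real^4 \<Rightarrow> real" where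
  "g4 i j k m y = u_fac y *
     (- w_fac y / 3 * (6 * Sijk i j k * Si11 m y + 6 * Sijk i j m * Si11 k y
        + 6 * Sijk i k m * Si11 j y + 6 * Sijk j k m * Si11 i y
        + Sij1 i j y * Sij1 k m y + Sij1 i k y * Sij1 j m y + Sij1 i m y * Sij1 j k y)
      + 4/9 * (w_fac y)\<^sup>2 * (Sij1 i j y * Si11 k y * Si11 m y + Sij1 i k y * Si11 j y * Si11 m y
        + Sij1 i m y * Si11 j y * Si11 k y + Sij1 j k y * Si11 i y * Si11 m y
        + Sij1 j m y * Si11 i y * Si11 k y + Sij1 k m y * Si11 i y * Si11 j y)
      - 28/27 * (w_fac y) ^ 3 * Si11 i y * Si11 j y * Si11 k y * Si11 m y)"

lemma has_pd_g2:
  assumes "S111 y \<noteq> 0"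
  shows "has_pd k (g2 i j) (g3 i j k y) y"
  unfolding g2_def
  by (rule DERIV_cdivide derivative_eq_intros has_pd_u_fac has_pd_w_fac has_pd_Si11 has_pd_Sij1 assms refl)+
    (simp add: g3_def Sij1_sym[of k] field_simps power2_eq_square)

lemma has_pd_g3:
  assumes "S111 y \<noteq> 0"
  shows "has_pd m (g3 i j k) (g4 i j k m y) y"
  unfolding g3_def
  by (rule DERIV_cdivide derivative_eq_intros has_pd_u_fac has_pd_w_fac has_pd_Si11 has_pd_Sij1 assms refl)+
    (simp add: g4_def Sij1_sym[of m] field_simps power2_eq_square power3_eq_cube)

lemma g3_sym: "g3 i j k = g3 j i k" "g3 i j k = g3 i k j"
  by (auto simp: g3_def fun_eq_iff Sijk_sym Sij1_sym algebra_simps)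

text \<open>This exchange makes the fourth derivatives cancel when the derivatives of the connection
  are antisymmetrized.\<close>

lemma g4_sym: "g4 i j k m y = g4 i m k j y"
  using Sijk_sym by (simp add: g4_def Sij1_sym algebra_simps)

text \<open>The factor \<open>h t\<close> cancels \<open>h_up h t\<close>, and the first derivative
  of the squared cube root is \<open>2 * u_fac v * Si11 j v\<close>.\<close>

lemma g_fund_eq:
  assumes "riemannian_metric_R h" "S111 y \<noteq> 0"
  shows "g_fund h i j t x y = g2 i j y"
proof -
  have h: "h t > 0"
    using assms by (simp add: riemannian_metric_R_def)
  then have F: "(F_chernov h t x v)\<^sup>2 = h_up h t * (root 3 (S111 v))\<^sup>2" for x v
    by (simp add: F_chernov_def power_mult_distrib h_up_def)
  have "dy j (\<lambda>t x y. (F_chernov h t x y)\<^sup>2) t x v = h_up h t * (2 * u_fac v * Si11 j v)"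
    if "S111 v \<noteq> 0" for v
  proof -
    have "has_pd j (\<lambda>v. (F_chernov h t x v)\<^sup>2) (h_up h t * (2 * u_fac v * Si11 j v)) v"
      unfolding F
      by (rule derivative_eq_intros has_pd_root_S111 that refl)+
        (use that in \<open>simp add: u_fac_def field_simps power2_eq_square\<close>)
    then show ?thesis
      unfolding dy_def by (rule pd_eqI)
  qed
  \<comment> \<open>The outer derivative needs the inner one near \<open>y\<close>, not only at
    \<open>y\<close>.\<close>
  then have "\<forall>\<^sub>F v in nhds y. dy j (\<lambda>t x y. (F_chernov h t x y)\<^sup>2) t x v =
      h_up h t * (2 * u_fac v * Si11 j v)"
    using eventually_S111_nonzero[OF assms(2)] by (auto elim: eventually_mono)
  moreover have "has_pd i (\<lambda>v. h_up h t * (2 * u_fac v * Si11 j v)) (h_up h t * (2 * g2 i j y)) y"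
    by (rule DERIV_cdivide derivative_eq_intros has_pd_u_fac has_pd_Si11 assms refl)+
      (simp add: g2_def algebra_simps)
  ultimately have "has_pd i (dy j (\<lambda>t x y. (F_chernov h t x y)\<^sup>2) t x) (h_up h t * (2 * g2 i j y)) y"
    by (rule has_pd_cong)
  then show ?thesis
    using h by (simp add: g_fund_def dy_def[of i] pd_eqI h_up_def)
qed

text \<open>Holding at every \<open>y\<close>, the identity can itself be differentiated in
  \<open>y\<close>.\<close>

lemma L_conn_eq: "L_conn h i j k t x y = kappa h t / 2 * C_conn h i j k t x y"
proof -
  have *: "delta_x h k (g_fund h i j) t x y = kappa h t / 2 * dy k (g_fund h i j) t x y" for i j k
    by (simp add: delta_x_def dx_def pd_def g_fund_def dy_def F_chernov_def)
  then show ?thesis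
    unfolding L_conn_def C_conn_def * sum_distrib_left
    by (intro sum.cong refl) (simp only: ring_distribs mult_ac times_divide_eq_right times_divide_eq_left)
qed

section \<open>The inverse Hessian of the cubic form\<close>

lemma Sjk1_up_inverse:
  assumes "invertible (Sij1_matrix y)"
  shows "(\<Sum>m\<in>UNIV. Sij1 a m y * Sjk1_up m b y) = (if a = b then 1 else 0)"
    and "(\<Sum>m\<in>UNIV. Sjk1_up a m y * Sij1 m b y) = (if a = b then 1 else 0)"
  using matrix_inv_inverse[OF assms]
  by (simp_all add: vec_eq_iff matrix_matrix_mult_def Sij1_matrix_def Sjk1_up_def mat_def)

text \<open>The transposed inverse of a symmetric matrix is again its inverse, so uniqueness
  applies.\<close>

lemma Sjk1_up_sym:
  assumes "invertible (Sij1_matrix y)"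
  shows "Sjk1_up a b y = Sjk1_up b a y"
proof -
  have tr: "transpose (Sij1_matrix y) = Sij1_matrix y"
    by (simp add: transpose_def Sij1_matrix_def Sij1_sym)
  let ?B = "matrix_inv (Sij1_matrix y)"
  have "?B = transpose ?B"
  proof (rule matrix_inv_unique)
    show "Sij1_matrix y ** transpose ?B = mat 1"
      using matrix_transpose_mul[of ?B "Sij1_matrix y"] by (simp add: tr matrix_inv_inverse[OF assms])
    show "transpose ?B ** Sij1_matrix y = mat 1"
      using matrix_transpose_mul[of "Sij1_matrix y" ?B] by (simp add: tr matrix_inv_inverse[OF assms])
  qed
  then have "?B $ a $ b = transpose ?B $ a $ b"
    by simp
  then show ?thesis
    by (simp add: Sjk1_up_def transpose_def)
qed

lemma Sjk1_up_Si11: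
  assumes "invertible (Sij1_matrix y)"
  shows "(\<Sum>m\<in>UNIV. Sjk1_up l m y * Si11 m y) = y $ l / 2"
proof -
  have "(\<Sum>m\<in>UNIV. Sjk1_up l m y * Si11 m y) =
      (\<Sum>m\<in>UNIV. \<Sum>j\<in>UNIV. Sjk1_up l m y * Sij1 m j y * y $ j) / 2"
    by (simp add: mult.assoc Sij1_contract sum_divide_distrib flip: sum_distrib_left)
  also have "\<dots> = (\<Sum>j\<in>UNIV. (\<Sum>m\<in>UNIV. Sjk1_up l m y * Sij1 m j y) * y $ j) / 2"
    by (subst sum.swap) (simp add: sum_distrib_right)
  finally show ?thesis
    by (simp add: Sjk1_up_inverse[OF assms] if_distrib if_distribR cong: if_cong)
qed

section \<open>The connection and its curvature\<close>

locale regular_point =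
  fixes h :: "real \<Rightarrow> real" and y :: "real^4"
  assumes metric: "riemannian_metric_R h"
    and nonzero: "S111 y \<noteq> 0"
    and regular: "invertible (Sij1_matrix y)"
begin

abbreviation "A i j \<equiv> Sij1 i j y"
abbreviation "B i j \<equiv> Sjk1_up i j y"
abbreviation "\<sigma> i \<equiv> Si11 i y"
abbreviation "u \<equiv> u_fac y"
abbreviation "w \<equiv> w_fac y"

lemma u_nonzero: "u \<noteq> 0"
  using nonzero by (simp add: u_fac_def)

lemma w_S111: "w * S111 y = 1"
  using nonzero by (simp add: w_fac_def)

text \<open>The Sherman-Morrison inverse of \<open>u * (A - w / 3 * \<sigma> \<sigma>^T)\<close>:
  here \<open>B \<sigma> = y / 2\<close>, and the denominator is
  \<open>1 - w / 3 * (3 * S111 y / 2) = 1/2\<close>.\<close>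

definition "ginv l m = (B l m + w / 6 * y $ l * y $ m) / u"

lemma g2_ginv: "(\<Sum>m\<in>UNIV. g2 a m y * ginv m b) = (if a = b then 1 else 0)"
proof -
  have "(\<Sum>m\<in>UNIV. g2 a m y * ginv m b) = (\<Sum>m\<in>UNIV. A a m * B m b + w / 6 * y $ b * (A a m * y $ m)
      - w / 3 * \<sigma> a * (B b m * \<sigma> m) - w\<^sup>2 / 18 * \<sigma> a * y $ b * (\<sigma> m * y $ m))"
    using u_nonzero
    by (intro sum.cong refl)
      (simp add: g2_def ginv_def Sjk1_up_sym[OF regular, of b] field_simps power2_eq_square)
  also have "\<dots> = (if a = b then 1 else 0) + w / 6 * y $ b * (2 * \<sigma> a)
      - w / 3 * \<sigma> a * (y $ b / 2) - w\<^sup>2 / 18 * \<sigma> a * y $ b * (3 * S111 y)"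
    by (simp only: sum.distrib sum_subtractf flip: sum_distrib_left)
      (simp only: Sjk1_up_inverse[OF regular] Sjk1_up_Si11[OF regular] Sij1_contract Si11_contract)
  \<comment> \<open>As \<open>w * S111 y = 1\<close>, the coefficients \<open>w / 3\<close>,
    \<open>- w / 6\<close> and \<open>- w / 6\<close> of \<open>\<sigma> a * y $ b\<close>
    cancel.\<close>
  also have "\<dots> = (if a = b then 1 else 0)"
    using w_S111 by (simp add: power2_eq_square algebra_simps)
  finally show ?thesis .
qed

lemma g2_matrix_inv:
  shows "invertible (\<chi> a b. g2 a b y)" and "matrix_inv (\<chi> a b. g2 a b y) = (\<chi> a b. ginv a b)"
proof -
  have *: "(\<chi> a b. g2 a b y) ** (\<chi> a b. ginv a b) = mat 1"
    using g2_ginv by (simp add: vec_eq_iff matrix_matrix_mult_def mat_def)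
  then have "(\<chi> a b. ginv a b) ** (\<chi> a b. g2 a b y) = mat 1"
    by (simp add: matrix_left_right_inverse)
  with * show "invertible (\<chi> a b. g2 a b y)"
    and "matrix_inv (\<chi> a b. g2 a b y) = (\<chi> a b. ginv a b)"
    by (auto intro: matrix_inv_unique simp: invertible_def)
qed

lemma g_up_eq: "g_up h l m t x y = ginv l m"
  by (simp add: g_up_def g_fund_eq[OF metric nonzero] g2_matrix_inv)

lemma eventually_nonzero: "\<forall>\<^sub>F v in nhds y. S111 v \<noteq> 0"
  using nonzero by (rule eventually_S111_nonzero)

section \<open>The vertical connection coefficients and their derivatives\<close>

lemma dy_g_fund:
  assumes "S111 v \<noteq> 0"
  shows "dy k (g_fund h i j) t x v = g3 i j k v"
proof -
  have "\<forall>\<^sub>F v in nhds v. g_fund h i j t x v = g2 i j v"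
    using eventually_S111_nonzero[OF assms] by eventually_elim (rule g_fund_eq[OF metric])
  then show ?thesis
    unfolding dy_def by (rule pd_eqI[OF has_pd_cong[OF _ has_pd_g2[OF assms]]])
qed

text \<open>For a Hessian metric \<open>g3\<close> is totally symmetric, so the three Christoffel
  terms collapse to one. The point \<open>v\<close> is kept variable for later
  differentiation.\<close>

lemma C_conn_eq_g3:
  assumes "S111 v \<noteq> 0"
  shows "C_conn h l i j t x v = (\<Sum>m\<in>UNIV. g_up h l m t x v * g3 i j m v / 2)"
proof -
  have "g3 i m j = g3 i j m" "g3 j m i = g3 i j m" for m
    by (rule g3_sym(2)) (rule trans[OF g3_sym(2) g3_sym(1)])
  then show ?thesis
    by (simp add: C_conn_def dy_g_fund[OF assms])
qed

definition "C l i j = (\<Sum>m\<in>UNIV. ginv l m * g3 i j m y / 2)"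

lemma C_conn_eq: "C_conn h l i j t x y = C l i j"
  by (simp add: C_conn_eq_g3[OF nonzero] C_def g_up_eq)

lemma C_sym: "C l i j = C l j i"
  by (simp add: C_def g3_sym(1)[of i])

text \<open>The product of the inverse metric with the \<open>k\<close>-th derivative of the metric
  is twice the matrix of \<open>C l b k\<close>, which absorbs one inverse in the general
  formula.\<close>

lemma has_pd_g_up:
  "has_pd k (g_up h l m t x) (- 2 * (\<Sum>b\<in>UNIV. C l b k * ginv b m)) y"
proof -
  define G where "G = (\<lambda>v. \<chi> a b. g2 a b v)"
  define G' where "G' = (\<chi> a b. g3 a b k y)"
  have inv: "invertible (G (y + 0 *\<^sub>R axis k 1))"
    and inv_eq: "matrix_inv (G (y + 0 *\<^sub>R axis k 1)) = (\<chi> a b. ginv a b)"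
    using g2_matrix_inv by (simp_all add: G_def)
  have "has_pd k (\<lambda>v. G v $ a $ b) (G' $ a $ b) y" for a b
    using has_pd_g2[OF nonzero] by (simp add: G_def G'_def)
  from matrix_inv_entry_has_field_derivative[OF this inv]
  have "has_pd k (\<lambda>v. matrix_inv (G v) $ l $ m)
      (- ((\<chi> a b. ginv a b) ** G' ** (\<chi> a b. ginv a b)) $ l $ m) y"
    by (simp only: inv_eq)
  moreover have "((\<chi> a b. ginv a b) ** G' ** (\<chi> a b. ginv a b)) $ l $ m =
      2 * (\<Sum>b\<in>UNIV. C l b k * ginv b m)"
  proof -
    have "(\<Sum>a\<in>UNIV. ginv l a * g3 a b k y) = 2 * C l b k" for b
    proof -
      have "g3 a b k = g3 b k a" for a
        by (rule trans[OF g3_sym])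
      then show ?thesis
        by (simp add: C_def flip: sum_divide_distrib)
    qed
    then show ?thesis
      by (simp add: matrix_matrix_mult_def G'_def sum_distrib_left mult.assoc)
  qed
  moreover have "\<forall>\<^sub>F v in nhds y. g_up h l m t x v = matrix_inv (G v) $ l $ m"
    using eventually_nonzero by eventually_elim (simp add: g_up_def G_def g_fund_eq[OF metric])
  ultimately show ?thesis
    by (auto intro: has_pd_cong[where g = "\<lambda>v. matrix_inv (G v) $ l $ m"])
qed

text \<open>The first sum is symmetric in \<open>j\<close> and \<open>k\<close>; only the quadratic
  one survives antisymmetrization.\<close>

definition "dC l i j k =
  (\<Sum>m\<in>UNIV. ginv l m * g4 i j m k y / 2) - 2 * (\<Sum>b\<in>UNIV. C l b k * C b i j)"

lemma has_pd_C_conn: "has_pd k (C_conn h l i j t x) (dC l i j k) y"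
proof -
  have "has_pd k (\<lambda>v. \<Sum>m\<in>UNIV. g_up h l m t x v * g3 i j m v / 2)
     (\<Sum>m\<in>UNIV. ((- 2 * (\<Sum>b\<in>UNIV. C l b k * ginv b m)) * g3 i j m y
        + ginv l m * g4 i j m k y) / 2) y"
    by (rule DERIV_cdivide has_pd_g_up has_pd_g3 nonzero derivative_eq_intros refl)+
      (simp add: g_up_eq algebra_simps)
  moreover have "(\<Sum>m\<in>UNIV. ((- 2 * (\<Sum>b\<in>UNIV. C l b k * ginv b m)) * g3 i j m y
        + ginv l m * g4 i j m k y) / 2) = dC l i j k"
  proof -
    have "(\<Sum>m\<in>UNIV. \<Sum>b\<in>UNIV. C l b k * ginv b m * g3 i j m y) = 2 * (\<Sum>b\<in>UNIV. C l b k * C b i j)"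
      by (subst sum.swap) (simp add: C_def sum_distrib_left mult.assoc)
    moreover have "((- 2 * a) * b + c) / 2 = c / 2 - a * b" for a b c :: real
      by (simp add: field_simps)
    ultimately show ?thesis
      by (simp only: dC_def sum_subtractf sum_distrib_right)
  qed
  moreover have "\<forall>\<^sub>F v in nhds y. C_conn h l i j t x v = (\<Sum>m\<in>UNIV. g_up h l m t x v * g3 i j m v / 2)"
    using eventually_nonzero by eventually_elim (rule C_conn_eq_g3)
  ultimately show ?thesis
    by (auto intro: has_pd_cong[where g = "\<lambda>v. \<Sum>m\<in>UNIV. g_up h l m t x v * g3 i j m v / 2"])
qed

lemma dy_C_conn: "dy k (C_conn h l i j) t x y = dC l i j k"
  unfolding dy_def by (rule pd_eqI[OF has_pd_C_conn])

section \<open>The curvature d-tensors as multiples of one commutator\<close>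

lemma dC_commutator:
  "dC l i j k - dC l i k j = 2 * (\<Sum>m\<in>UNIV. C m i k * C l m j) - 2 * (\<Sum>m\<in>UNIV. C m i j * C l m k)"
  unfolding dC_def by (simp add: g4_sym[of i j _ k] mult.commute)

text \<open>The derivatives contribute the commutator twice, and the quadratic terms remove it
  once.\<close>

lemma S_curv_eq:
  "S_curv h l i j k t x y = (\<Sum>m\<in>UNIV. C m i k * C l m j) - (\<Sum>m\<in>UNIV. C m i j * C l m k)"
  using dC_commutator[of l i j k] by (simp add: S_curv_def dy_C_conn C_conn_eq)

lemma dy_L_conn: "dy k (L_conn h l i j) t x y = kappa h t / 2 * dC l i j k"
proof -
  have "L_conn h l i j t x = (\<lambda>v. kappa h t / 2 * C_conn h l i j t x v)"
    by (simp add: L_conn_eq fun_eq_iff)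
  then show ?thesis
    unfolding dy_def by (simp only: pd_eqI[OF DERIV_cmult[OF has_pd_C_conn]])
qed

lemma dx_C_conn: "dx k (C_conn h l i j) t x y = 0"
  by (simp add: dx_def pd_def C_conn_def g_up_def g_fund_def dy_def F_chernov_def)

lemma dx_L_conn: "dx k (L_conn h l i j) t x y = 0"
  unfolding dx_def pd_def L_conn_eq
  by (simp add: C_conn_def g_up_def g_fund_def dy_def F_chernov_def)

lemma R_curv_eq: "R_curv h l i j k t x y = 1/4 * kappa h t * kappa h t * S_curv h l i j k t x y"
proof -
  have "R_curv h l i j k t x y = kappa h t / 2 * (kappa h t / 2 * (dC l i j k - dC l i k j))
      + (kappa h t / 2)\<^sup>2 * ((\<Sum>m\<in>UNIV. C m i j * C l m k) - (\<Sum>m\<in>UNIV. C m i k * C l m j))"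
    unfolding R_curv_def delta_x_def dx_L_conn dy_L_conn
    by (simp add: L_conn_eq C_conn_eq sum_distrib_left algebra_simps power2_eq_square)
  then show ?thesis
    unfolding dC_commutator S_curv_eq by (simp add: power2_eq_square algebra_simps)
qed

text \<open>Since \<open>N_conn\<close> is constant in \<open>y\<close>, the torsion is minus
  \<open>L_conn\<close>, and its term cancels the last sum of the covariant derivative.\<close>

lemma P_curv_eq: "P_curv h l i j k t x y = 1/2 * kappa h t * S_curv h l i j k t x y"
proof -
  have N: "dy k (N_conn h m j) t x y = 0" for m
    by (simp add: dy_def pd_def N_conn_def)
  have "P_curv h l i j k t x y = kappa h t / 2 * (dC l i j k - dC l i k j)
      + kappa h t / 2 * ((\<Sum>m\<in>UNIV. C m i j * C l m k) - (\<Sum>m\<in>UNIV. C m i k * C l m j))"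
    unfolding P_curv_def C_cov_def P_tors_def N delta_x_def dx_C_conn dy_L_conn dy_C_conn
    by (simp add: L_conn_eq C_conn_eq sum_distrib_left sum_negf algebra_simps)
  then show ?thesis
    unfolding dC_commutator S_curv_eq by (simp add: algebra_simps)
qed

section \<open>Contraction of the vertical curvature\<close>

text \<open>Twice the Christoffel symbols of the Hessian metric \<open>A\<close>; the factor 6 turns
  \<open>Sijk\<close> into the third derivative of \<open>S111\<close>.\<close>

definition "U l i j = (\<Sum>m\<in>UNIV. B l m * (6 * Sijk i j m))"

abbreviation "\<delta> i j \<equiv> (if i = j then 1 else 0 :: real)"

lemma C_eq: "C l i j = (U l i j - w / 6 * A i j * y $ l - w / 3 * (\<delta> l i * \<sigma> j + \<delta> l j * \<sigma> i)
    + 2/9 * w\<^sup>2 * \<sigma> i * \<sigma> j * y $ l) / 2"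
proof -
  have "2 * C l i j = (\<Sum>m\<in>UNIV. 2 * (ginv l m * g3 i j m y / 2))"
    by (simp only: C_def sum_distrib_left)
  also have "\<dots> = (\<Sum>m\<in>UNIV. B l m * (6 * Sijk i j m)
      + (4/9 * w\<^sup>2 * \<sigma> i * \<sigma> j - w / 3 * A i j) * (B l m * \<sigma> m)
      - w / 3 * \<sigma> j * (B l m * A m i) - w / 3 * \<sigma> i * (B l m * A m j)
      + w * y $ l * (Sijk i j m * y $ m)
      + (2/27 * w ^ 3 * y $ l * \<sigma> i * \<sigma> j - w\<^sup>2 / 18 * y $ l * A i j) * (\<sigma> m * y $ m)
      - w\<^sup>2 / 18 * y $ l * \<sigma> j * (A i m * y $ m) - w\<^sup>2 / 18 * y $ l * \<sigma> i * (A j m * y $ m))"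
    using u_nonzero
    by (intro sum.cong refl)
      (simp add: ginv_def g3_def Sij1_sym[of m for m] field_simps power2_eq_square power3_eq_cube)
  also have "\<dots> = U l i j + (4/9 * w\<^sup>2 * \<sigma> i * \<sigma> j - w / 3 * A i j) * (y $ l / 2)
      - w / 3 * \<sigma> j * \<delta> l i - w / 3 * \<sigma> i * \<delta> l j
      + w * y $ l * (A i j / 6)
      + (2/27 * w ^ 3 * y $ l * \<sigma> i * \<sigma> j - w\<^sup>2 / 18 * y $ l * A i j) * (3 * S111 y)
      - w\<^sup>2 / 18 * y $ l * \<sigma> j * (2 * \<sigma> i) - w\<^sup>2 / 18 * y $ l * \<sigma> i * (2 * \<sigma> j)"
    by (simp only: sum.distrib sum_subtractf U_def flip: sum_distrib_left)
      (simp only: Sjk1_up_inverse[OF regular] Sjk1_up_Si11[OF regular] Sij1_contract Si11_contract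
        Sijk_contract)
  \<comment> \<open>Isolates the factor \<open>w * S111 y\<close>, which equals 1.\<close>
  also have "(2/27 * w ^ 3 * y $ l * \<sigma> i * \<sigma> j - w\<^sup>2 / 18 * y $ l * A i j) * (3 * S111 y)
      = (2/9 * w\<^sup>2 * y $ l * \<sigma> i * \<sigma> j - w / 6 * y $ l * A i j) * (w * S111 y)"
    by (simp add: algebra_simps power2_eq_square power3_eq_cube)
  finally show ?thesis
    unfolding w_S111 by (simp add: algebra_simps)
qed

lemma U_contract: "(\<Sum>j\<in>UNIV. U l i j * y $ j) = \<delta> l i"
proof -
  have "(\<Sum>j\<in>UNIV. U l i j * y $ j) = (\<Sum>m\<in>UNIV. B l m * (6 * (\<Sum>j\<in>UNIV. Sijk i m j * y $ j)))"
    unfolding U_def sum_distrib_left sum_distrib_right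
    by (subst sum.swap) (simp add: Sijk_sym(2)[of i _ m for m] mult_ac)
  then show ?thesis
    by (simp add: Sijk_contract Sij1_sym[of i] Sjk1_up_inverse[OF regular])
qed

lemma Si11_U: "(\<Sum>l\<in>UNIV. \<sigma> l * U l i j) = A i j / 2"
proof -
  have "(\<Sum>l\<in>UNIV. \<sigma> l * U l i j) = (\<Sum>m\<in>UNIV. (\<Sum>l\<in>UNIV. B m l * \<sigma> l) * (6 * Sijk i j m))"
    unfolding U_def sum_distrib_left sum_distrib_right
    by (subst sum.swap) (simp add: Sjk1_up_sym[OF regular, of m for m] mult_ac)
  also have "\<dots> = 3 * (\<Sum>m\<in>UNIV. Sijk i j m * y $ m)"
    by (simp only: Sjk1_up_Si11[OF regular]) (simp add: sum_distrib_left mult_ac)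
  finally show ?thesis
    by (simp add: Sijk_contract)
qed

text \<open>Conceptually, the metric is homogeneous of degree 0 in \<open>y\<close>, so its
  derivative along \<open>y\<close> vanishes. In closed form, the factor
  \<open>1 - w * S111 y\<close> appears.\<close>

lemma C_contract: "(\<Sum>j\<in>UNIV. C l i j * y $ j) = 0"
proof -
  have "(\<Sum>j\<in>UNIV. C l i j * y $ j) = (\<Sum>j\<in>UNIV. 1/2 * (U l i j * y $ j)
      - w / 12 * y $ l * (A i j * y $ j) + (w\<^sup>2 / 9 * \<sigma> i * y $ l - w / 6 * \<delta> l i) * (\<sigma> j * y $ j)
      - w / 6 * \<sigma> i * (\<delta> l j * y $ j))"
    by (intro sum.cong refl) (simp only: C_eq, simp add: field_simps)
  also have "\<dots> = 1/2 * \<delta> l i - w / 12 * y $ l * (2 * \<sigma> i)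
      + (w\<^sup>2 / 9 * \<sigma> i * y $ l - w / 6 * \<delta> l i) * (3 * S111 y) - w / 6 * \<sigma> i * y $ l"
    by (simp only: sum.distrib sum_subtractf flip: sum_distrib_left)
      (simp add: U_contract Sij1_contract Si11_contract if_distrib if_distribR cong: if_cong)
  also have "\<dots> = (1 - w * S111 y) * (\<delta> l i / 2 - w / 3 * y $ l * \<sigma> i)"
    by (simp add: field_simps power2_eq_square)
  finally show ?thesis
    by (simp add: w_S111)
qed

text \<open>Raising the index of \<open>\<sigma>\<close> with \<open>ginv\<close> gives
  \<open>y / u\<close>, so this is again the derivative of the metric along
  \<open>y\<close>.\<close>

lemma Si11_C: "(\<Sum>l\<in>UNIV. \<sigma> l * C l i j) = 0"
proof -
  have "(\<Sum>l\<in>UNIV. \<sigma> l * C l i j) = (\<Sum>l\<in>UNIV. 1/2 * (\<sigma> l * U l i j)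
      + (w\<^sup>2 / 9 * \<sigma> i * \<sigma> j - w / 12 * A i j) * (\<sigma> l * y $ l)
      - w / 6 * \<sigma> j * (\<delta> l i * \<sigma> l) - w / 6 * \<sigma> i * (\<delta> l j * \<sigma> l))"
    by (intro sum.cong refl) (simp only: C_eq, simp add: field_simps)
  also have "\<dots> = 1/2 * (A i j / 2) + (w\<^sup>2 / 9 * \<sigma> i * \<sigma> j - w / 12 * A i j) * (3 * S111 y)
      - w / 6 * \<sigma> j * \<sigma> i - w / 6 * \<sigma> i * \<sigma> j"
    by (simp only: sum.distrib sum_subtractf flip: sum_distrib_left)
      (simp add: Si11_U Si11_contract if_distrib if_distribR cong: if_cong)
  also have "\<dots> = (1 - w * S111 y) * (A i j / 4 - w / 3 * \<sigma> i * \<sigma> j)"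
    by (simp add: field_simps power2_eq_square)
  finally show ?thesis
    by (simp add: w_S111)
qed

text \<open>The logarithmic derivative of the determinant of \<open>A\<close>.\<close>

definition tau ("\<tau>") where "\<tau> i = (\<Sum>r\<in>UNIV. U r i r)"

lemma C_trace: "(\<Sum>r\<in>UNIV. C r i r) = \<tau> i / 2 - 2/3 * w * \<sigma> i"
proof -
  have "(\<Sum>r\<in>UNIV. C r i r) = (\<Sum>r\<in>UNIV. 1/2 * U r i r - w / 12 * (A i r * y $ r)
      + w\<^sup>2 / 9 * \<sigma> i * (\<sigma> r * y $ r) - w / 6 * (\<delta> r i * \<sigma> r) - w / 6 * \<sigma> i * 1)"
    by (intro sum.cong refl) (simp only: C_eq, simp add: field_simps)
  \<comment> \<open>The final 4 is the dimension, coming from the trace of the identity.\<close>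
  also have "\<dots> = 1/2 * \<tau> i - w / 12 * (2 * \<sigma> i) + w\<^sup>2 / 9 * \<sigma> i * (3 * S111 y)
      - w / 6 * \<sigma> i - w / 6 * \<sigma> i * 4"
    by (simp only: sum.distrib sum_subtractf flip: sum_distrib_left)
      (simp add: tau_def Sij1_contract Si11_contract if_distrib if_distribR cong: if_cong)
  also have "\<dots> = \<tau> i / 2 - w * \<sigma> i + w / 3 * \<sigma> i * (w * S111 y)"
    by (simp add: algebra_simps power2_eq_square)
  finally show ?thesis
    unfolding w_S111 by (simp add: algebra_simps)
qed

section \<open>The two quadratic contractions in the vertical Ricci tensor\<close>

lemma Ricci_S_eq_C:
  "Ricci_S h i j t x y = (\<Sum>r\<in>UNIV. \<Sum>m\<in>UNIV. C m i r * C r j m) - (\<Sum>m\<in>UNIV. C m i j * (\<Sum>r\<in>UNIV. C r m r))"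
proof -
  have "(\<Sum>r\<in>UNIV. \<Sum>m\<in>UNIV. C m i j * C r m r) = (\<Sum>m\<in>UNIV. C m i j * (\<Sum>r\<in>UNIV. C r m r))"
    by (subst sum.swap) (simp add: sum_distrib_left)
  then show ?thesis
    by (simp add: Ricci_S_def S_curv_eq sum_subtractf C_sym[of _ j])
qed

lemma U_sym: "U l i j = U l j i"
  by (simp add: U_def Sijk_sym(1)[of i])

text \<open>Euler's relation for the determinant of \<open>A\<close>, homogeneous of degree
  4.\<close>

lemma tau_contract: "(\<Sum>m\<in>UNIV. y $ m * \<tau> m) = 4"
proof -
  have "(\<Sum>m\<in>UNIV. y $ m * \<tau> m) = (\<Sum>r\<in>UNIV. \<Sum>m\<in>UNIV. U r r m * y $ m)"
    unfolding tau_def sum_distrib_left by (subst sum.swap) (simp add: U_sym mult.commute)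
  then show ?thesis
    by (simp add: U_contract)
qed

text \<open>The \<open>\<sigma>\<close> part of the trace drops out by \<open>Si11_C\<close>,
  leaving only \<open>\<tau>\<close> to be paired with \<open>C\<close>.\<close>

lemma sum_C_trace: "(\<Sum>m\<in>UNIV. C m i j * (\<Sum>r\<in>UNIV. C r m r)) =
    (\<Sum>m\<in>UNIV. U m i j * \<tau> m) / 4 - w / 6 * A i j - w / 12 * (\<sigma> i * \<tau> j + \<sigma> j * \<tau> i)
    + 2/9 * w\<^sup>2 * \<sigma> i * \<sigma> j"
proof -
  have "(\<Sum>m\<in>UNIV. C m i j * (\<Sum>r\<in>UNIV. C r m r)) =
      (\<Sum>m\<in>UNIV. 1/2 * (C m i j * \<tau> m) - 2/3 * w * (\<sigma> m * C m i j))"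
    by (intro sum.cong refl) (simp add: C_trace algebra_simps)
  also have "\<dots> = 1/2 * (\<Sum>m\<in>UNIV. C m i j * \<tau> m)"
    by (simp only: sum_subtractf Si11_C flip: sum_distrib_left)
  also have "(\<Sum>m\<in>UNIV. C m i j * \<tau> m) = (\<Sum>m\<in>UNIV. 1/2 * (U m i j * \<tau> m)
      + (w\<^sup>2 / 9 * \<sigma> i * \<sigma> j - w / 12 * A i j) * (y $ m * \<tau> m)
      - w / 6 * \<sigma> j * (\<delta> m i * \<tau> m) - w / 6 * \<sigma> i * (\<delta> m j * \<tau> m))"
    by (intro sum.cong refl) (simp only: C_eq, simp add: field_simps)
  also have "\<dots> = 1/2 * (\<Sum>m\<in>UNIV. U m i j * \<tau> m)
      + (w\<^sup>2 / 9 * \<sigma> i * \<sigma> j - w / 12 * A i j) * 4 - w / 6 * \<sigma> j * \<tau> i - w / 6 * \<sigma> i * \<tau> j"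
    by (simp only: sum.distrib sum_subtractf tau_contract flip: sum_distrib_left)
      (simp add: if_distrib if_distribR cong: if_cong)
  finally show ?thesis
    by (simp add: field_simps)
qed

text \<open>The factors are expanded one at a time. Replacing \<open>C r j m\<close> first lets
  \<open>C_contract\<close> remove every term with \<open>y\<close>; the other factor is then
  contracted with \<open>U\<close> alone.\<close>

lemma sum_C_C: "(\<Sum>r\<in>UNIV. \<Sum>m\<in>UNIV. C m i r * C r j m) =
    (\<Sum>r\<in>UNIV. \<Sum>m\<in>UNIV. U m i r * U r j m) / 4
    - w / 12 * A i j - w / 12 * (\<sigma> i * \<tau> j + \<sigma> j * \<tau> i) + w\<^sup>2 / 6 * \<sigma> i * \<sigma> j"
proof -
  have inner: "(\<Sum>r\<in>UNIV. C m i r * C r j m) =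
      1/2 * (\<Sum>r\<in>UNIV. C m i r * U r j m) - w / 6 * (\<sigma> m * C m i j) - w / 6 * \<sigma> j * C m i m" for m
  proof -
    have "(\<Sum>r\<in>UNIV. C m i r * C r j m) = (\<Sum>r\<in>UNIV. 1/2 * (C m i r * U r j m)
        + (w\<^sup>2 / 9 * \<sigma> j * \<sigma> m - w / 12 * A j m) * (C m i r * y $ r)
        - w / 6 * \<sigma> m * (\<delta> r j * C m i r) - w / 6 * \<sigma> j * (\<delta> r m * C m i r))"
      by (intro sum.cong refl) (simp only: C_eq[of _ j], simp add: field_simps)
    also have "\<dots> = 1/2 * (\<Sum>r\<in>UNIV. C m i r * U r j m) - w / 6 * \<sigma> m * C m i j - w / 6 * \<sigma> j * C m i m"
      by (simp only: sum.distrib sum_subtractf C_contract flip: sum_distrib_left)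
        (simp add: if_distrib if_distribR cong: if_cong)
    finally show ?thesis
      by simp
  qed
  have inner': "(\<Sum>m\<in>UNIV. C m i r * U r j m) =
      1/2 * (\<Sum>m\<in>UNIV. U m i r * U r j m) + (w\<^sup>2 / 9 * \<sigma> i * \<sigma> r - w / 12 * A i r) * \<delta> r j
      - w / 6 * (\<sigma> r * U r i j) - w / 6 * \<sigma> i * U r j r" for r
  proof -
    have "(\<Sum>m\<in>UNIV. C m i r * U r j m) = (\<Sum>m\<in>UNIV. 1/2 * (U m i r * U r j m)
        + (w\<^sup>2 / 9 * \<sigma> i * \<sigma> r - w / 12 * A i r) * (U r j m * y $ m)
        - w / 6 * \<sigma> r * (\<delta> m i * U r j m) - w / 6 * \<sigma> i * (\<delta> m r * U r j m))"
      by (intro sum.cong refl) (simp only: C_eq, simp add: field_simps)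
    also have "\<dots> = 1/2 * (\<Sum>m\<in>UNIV. U m i r * U r j m)
        + (w\<^sup>2 / 9 * \<sigma> i * \<sigma> r - w / 12 * A i r) * \<delta> r j
        - w / 6 * \<sigma> r * U r j i - w / 6 * \<sigma> i * U r j r"
      by (simp only: sum.distrib sum_subtractf U_contract flip: sum_distrib_left)
        (simp add: if_distrib if_distribR cong: if_cong)
    finally show ?thesis
      by (simp add: U_sym[of r j i])
  qed
  have "(\<Sum>r\<in>UNIV. \<Sum>m\<in>UNIV. C m i r * C r j m) = (\<Sum>m\<in>UNIV. \<Sum>r\<in>UNIV. C m i r * C r j m)"
    by (rule sum.swap)
  also have "\<dots> = 1/2 * (\<Sum>m\<in>UNIV. \<Sum>r\<in>UNIV. C m i r * U r j m)
      - w / 6 * \<sigma> j * (\<tau> i / 2 - 2/3 * w * \<sigma> i)"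
    by (simp only: inner sum_subtractf Si11_C C_trace flip: sum_distrib_left)
  also have "(\<Sum>m\<in>UNIV. \<Sum>r\<in>UNIV. C m i r * U r j m) = (\<Sum>r\<in>UNIV. \<Sum>m\<in>UNIV. C m i r * U r j m)"
    by (rule sum.swap)
  also have "\<dots> = 1/2 * (\<Sum>r\<in>UNIV. \<Sum>m\<in>UNIV. U m i r * U r j m)
      + (w\<^sup>2 / 9 * \<sigma> i * \<sigma> j - w / 12 * A i j) - w / 6 * (A i j / 2) - w / 6 * \<sigma> i * \<tau> j"
    by (simp only: inner' sum.distrib sum_subtractf Si11_U tau_def[symmetric] flip: sum_distrib_left)
      (simp add: if_distrib if_distribR cong: if_cong)
  finally show ?thesis
    by (simp add: field_simps power2_eq_square)
qed

text \<open>Each of \<open>U\<close> and \<open>\<tau>\<close> carries a factor 6, whence 36; the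
  rest is reindexing by the symmetry of \<open>B\<close>.\<close>

lemma U_trace_contraction:
  "(\<Sum>m\<in>UNIV. U m i j * \<tau> m) = 36 *
    (\<Sum>p\<in>UNIV. \<Sum>q\<in>UNIV. \<Sum>r\<in>UNIV. \<Sum>m\<in>UNIV. B p q * B r m * (Sijk i j p * Sijk q r m))"
proof -
  have "(\<Sum>m\<in>UNIV. U m i j * \<tau> m) = (\<Sum>q\<in>UNIV. \<Sum>p\<in>UNIV. \<Sum>r\<in>UNIV. \<Sum>m\<in>UNIV.
      36 * (B p q * B r m * (Sijk i j p * Sijk q r m)))"
    unfolding U_def tau_def sum_product unfolding sum_distrib_left
    by (intro sum.cong refl) (subst Sjk1_up_sym[OF regular], simp)
  then show ?thesis
    by (subst sum.swap) (simp only: sum_distrib_left)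
qed

lemma U_U_contraction:
  "(\<Sum>r\<in>UNIV. \<Sum>m\<in>UNIV. U m i r * U r j m) = 36 *
    (\<Sum>p\<in>UNIV. \<Sum>q\<in>UNIV. \<Sum>r\<in>UNIV. \<Sum>m\<in>UNIV. B p q * B r m * (Sijk i p r * Sijk j q m))"
proof -
  have "(\<Sum>r\<in>UNIV. \<Sum>q\<in>UNIV. U q i r * U r j q) =
      (\<Sum>r\<in>UNIV. \<Sum>q\<in>UNIV. \<Sum>p\<in>UNIV. \<Sum>m\<in>UNIV. 36 * (B p q * B r m * (Sijk i p r * Sijk j q m)))"
    unfolding U_def sum_product
    by (intro sum.cong refl) (subst Sjk1_up_sym[OF regular], subst Sijk_sym(2), simp)
  also have "\<dots> = (\<Sum>q\<in>UNIV. \<Sum>p\<in>UNIV. \<Sum>r\<in>UNIV. \<Sum>m\<in>UNIV. 36 * (B p q * B r m * (Sijk i p r * Sijk j q m)))"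
    by (subst sum.swap) (intro sum.cong refl sum.swap)
  also have "\<dots> = (\<Sum>p\<in>UNIV. \<Sum>q\<in>UNIV. \<Sum>r\<in>UNIV. \<Sum>m\<in>UNIV. 36 * (B p q * B r m * (Sijk i p r * Sijk j q m)))"
    by (rule sum.swap)
  finally show ?thesis
    by (simp only: sum_distrib_left)
qed

text \<open>The \<open>\<tau>\<close> terms cancel in the difference, and the coefficients are
  \<open>36/4 = 9\<close>, \<open>1/6 - 1/12 = 1/12\<close> and
  \<open>1/6 - 2/9 = - 1/18\<close>.\<close>

lemma Ricci_S_eq:
  "Ricci_S h i j t x y =
      - 9 * (\<Sum>p\<in>UNIV. \<Sum>q\<in>UNIV. \<Sum>r\<in>UNIV. \<Sum>m\<in>UNIV. B p q * B r m *
          (Sijk i j p * Sijk q r m - Sijk i p r * Sijk j q m))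
      + 1/12 * (1 / S111 y) * A i j - 1/18 * (1 / (S111 y)\<^sup>2) * \<sigma> i * \<sigma> j"
  unfolding Ricci_S_eq_C sum_C_C sum_C_trace U_trace_contraction U_U_contraction
  by (simp add: right_diff_distrib sum_subtractf w_fac_def field_simps)

end

theorem theorem5p1:
  fixes h :: "real \<Rightarrow> real" and t :: real and x y :: "real^4" and i j :: 4
  assumes "riemannian_metric_R h"
    and "S111 y \<noteq> 0"
    and "invertible (Sij1_matrix y)"
  shows "Ricci_R h i j t x y = 1/4 * kappa h t * kappa h t * Ricci_S h i j t x y \<and>
    Ricci_P_hv h i j t x y = Ricci_P_vh h i j t x y \<and>
    Ricci_P_vh h i j t x y = 1/2 * kappa h t * Ricci_S h i j t x y \<and>
    Ricci_S h i j t x y =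
      - 9 * (\<Sum>p\<in>UNIV. \<Sum>q\<in>UNIV. \<Sum>r\<in>UNIV. \<Sum>m\<in>UNIV. Sjk1_up p q y * Sjk1_up r m y *
          (Sijk i j p * Sijk q r m - Sijk i p r * Sijk j q m))
      + 1/12 * (1 / S111 y) * Sij1 i j y
      - 1/18 * (1 / (S111 y)\<^sup>2) * Si11 i y * Si11 j y"
proof -
  interpret regular_point h y
    using assms by unfold_locales
  have "Ricci_R h i j t x y = 1/4 * kappa h t * kappa h t * Ricci_S h i j t x y"
    by (simp only: Ricci_R_def Ricci_S_def R_curv_eq sum_distrib_left)
  moreover have "Ricci_P_vh h i j t x y = 1/2 * kappa h t * Ricci_S h i j t x y"
    by (simp only: Ricci_P_vh_def Ricci_S_def P_curv_eq sum_distrib_left)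
  ultimately show ?thesis
    using Ricci_S_eq by (simp add: Ricci_P_hv_def Ricci_P_vh_def)
qed

end
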